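(* Let $\lambda$ be a partition with $n=\ell(\lambda)$ parts, let $\sigma\in\mathcal{T}(\lambda)$ be a canonical filling with largest entry $N$, and for $1\le i\le j\le n$ let $\nu_{i,j}^k$ and $s_m^h=s_m^h(i,j)$ be as defined below. Then for all $1\le i\le j\le n$: (a) $D_{i,j}(\sigma)=(j-i)\sum_{k=1}^{N-1}\big(s_N^k-s_k^k\big)$; (b) $\bar\eta_{i,j}(\sigma)=\xi_1(s,\nu_{i,j})+\sum_{k=1}^{N}\binom{\nu_{i,j}^k-\nu_{i,j}^{k-1}}{2}+\sum_{k=1}^{N-1}\sum_{h=1}^{k}(s_{k+1}^h-s_k^h)s_k^h+\sum_{k=1}^{N-1}\big(\nu_{i,j}^{k+1}-s_{k+1}^{1,k}-\nu_{i,j}^{k}+s_k^{1,k}\big)\big(\nu_{i,j}^{k}-s_k^{1,k}\big)$, where $\xi_1(s,\nu_{i,j})=\sum_{1\le h\le k<N}(s_{k+1}^h-s_k^h)(\nu_{i,j}^k-s_k^{h,k})$; and moreover (c) $\overline{\mathrm{quinv}}(\sigma)=\sum_{1\le i\le j\le n}\Big[(\lambda_i-\lambda_j)\sum_{k=1}^{N-1}\big(s_N^k(i,j)-s_k^k(i,j)\big)+\sum_{k=1}^{N}\sum_{\ell=j+1}^{n}(\nu_{i,j}^k-\nu_{i,j}^{k-1})(\nu_{i,\ell}^k-\nu_{i+1,\ell}^{k-1})\Big]$.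
   Context: $\lambda=(\lambda_1\ge\cdots\ge\lambda_n>0)$, $\lambda_{n+1}=0$; French Young diagram with cells $(r,c)$ (row $r$ from bottom, column $c$ from left), $\lambda'_c$ = height of column $c$. Fillings assign positive integers; convention: an extra entry $0$ on top of each column ($\sigma(\lambda'_c+1,c)=0$). For $1\le j\le n$, $\sigma_j$ is the restriction of $\sigma$ to the columns of height $j$ (columns $\lambda_{j+1}<c\le\lambda_j$), with row $j+1$ of $\sigma_j$ consisting of $0$'s. Canonical: a rectangular filling of height $m$ (row $m+1$ all $0$) is canonical if for every $1\le r\le m$: (I) whenever two columns have the same entry $a$ in row $r+1$ and entries $b$ (left) and $c$ (right) in row $r$, then $a>b\ge c$ or $c\ge a>b$ or $b\ge c\ge a$; (II) whenever two columns, the left with $a$ (row $r+1$) over $c$ (row $r$) and the right with $b$ over $d$, satisfy $a\le c$ and $b\le d$, then $a\ge b$ implies $c\ge d$ and $a<b$ implies $c\le d$. $\sigma$ is canonical if every $\sigma_j$ is. Quantities: $\nu_{i,j}^k$ ($0\le k\le N$) is the number of entries $\ge N+1-k$ in row $i$ of $\sigma_j$ (so $\nu_{i,j}^0=0$), and $\nu_{\ell+1,\ell}^k:=0$. For $1\le h\le m\le N$, $s_m^h(i,j)$ is the number of columns of $\sigma_j$ whose entry in row $i+1$ is $N+1-h$ and whose entry in row $i$ is $\ge N+1-m$; $s_m^{h,k}=\sum_{a=h}^k s_m^a$ (in (a),(b) $s$ means $s(i,j)$). $D_{i,j}(\sigma)=\sum(\lambda'_c-i)$ over the columns $c$ of $\sigma_j$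 with $\sigma(i+1,c)>\sigma(i,c)$ (the contribution to $\mathrm{maj}(\sigma)$ of descents in row $i+1$ of $\sigma_j$; here $\lambda'_c-i=j-i$). Pattern set $S_2$: consists of the chains $z=w>v>u$, $u\ge z=w>v$, $v>u\ge z=w$ (set $S^*$) and six chains $z>v\ge w>u$, $u\ge z>v\ge w$, $z>w>v>u$, $v>u\ge z>w$, $z>u>v\ge w$, $v\ge z>w>u$. $Q_{S_2}(z,w,u,v)=1$ iff $(z,w,u,v)$ satisfies a chain of $S^*$, or one of the six chains, or $(w,z,v,u)$ satisfies one of the six chains; else $0$. $\bar\eta_{i,j}(\sigma)$ is the number of 4-tuples of cells $(i+1,c),(i+1,d),(i,c),(i,d)$ with $c<d$ columns of $\sigma_j$ and $Q_{S_2}(\sigma(i+1,c),\sigma(i+1,d),\sigma(i,c),\sigma(i,d))=0$. $Q(a,b,c)=1$ iff $a<b<c$ or $b<c<a$ or $c<a<b$ or $a=b\ne c$. $\overline{\mathrm{quinv}}(\sigma)$ is the number of triples of cells $((r+1,c),(r,c),(r,d))$ with $c<d$, $1\le r\le\lambda'_d<\lambda'_c$ and $Q(\sigma(r+1,c),\sigma(r,c),\sigma(r,d))=0$. *)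

theory Defs
  imports Main
begin

text \<open>
  A partition is the list \<open>lam\<close> of its parts.  Parts, rows and columns are numbered from 1
  (French convention: row 1 is the bottom row), and \<open>part lam i\<close> is 0 for \<open>i > length lam\<close>.
\<close>

definition is_partition :: "nat list \<Rightarrow> bool" where
  "is_partition lam \<longleftrightarrow> sorted_wrt (\<ge>) lam \<and> (\<forall>x\<in>set lam. 0 < x)"

definition part :: "nat list \<Rightarrow> nat \<Rightarrow> nat" where
  "part lam i = (if 1 \<le> i \<and> i \<le> length lam then lam ! (i - 1) else 0)"

definition cells :: "nat list \<Rightarrow> (nat \<times> nat) set" where
  "cells lam = {(r, c). 1 \<le> r \<and> r \<le> length lam \<and> 1 \<le> c \<and> c \<le> part lam r}"

definition col_height :: "nat list \<Rightarrow> nat \<Rightarrow> nat" where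
  "col_height lam c = card {r. (r, c) \<in> cells lam}"

text \<open>
  \<open>\<sigma> r c\<close> is the entry in row \<open>r\<close>, column \<open>c\<close>.  Fillings are 0 outside the diagram; this makes
  them determined by their entries in the diagram, and contains the convention
  \<open>\<sigma> (col_height lam c + 1) c = 0\<close>.
\<close>

definition fillings :: "nat list \<Rightarrow> (nat \<Rightarrow> nat \<Rightarrow> nat) set" where
  "fillings lam = {\<sigma>. \<forall>r c. if (r, c) \<in> cells lam then 0 < \<sigma> r c else \<sigma> r c = 0}"

definition entries :: "nat list \<Rightarrow> (nat \<Rightarrow> nat \<Rightarrow> nat) \<Rightarrow> nat set" where
  "entries lam \<sigma> = (\<lambda>(r, c). \<sigma> r c) ` cells lam"

text \<open>
  The columns of height \<open>j\<close>.  The rectangular filling \<open>\<sigma>\<^sub>j\<close> is \<open>\<sigma>\<close> read on these columns; its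
  row \<open>j + 1\<close> is 0 by the convention above.
\<close>

definition block_cols :: "nat list \<Rightarrow> nat \<Rightarrow> nat set" where
  "block_cols lam j = {c. part lam (j + 1) < c \<and> c \<le> part lam j}"

definition canonical_rect :: "nat \<Rightarrow> nat set \<Rightarrow> (nat \<Rightarrow> nat \<Rightarrow> nat) \<Rightarrow> bool" where
  "canonical_rect m C \<sigma> \<longleftrightarrow>
    (\<forall>r\<in>{1..m}.
      (\<forall>p\<in>C. \<forall>q\<in>C. p < q \<longrightarrow>
        (\<forall>a b c. \<sigma> (r + 1) p = a \<and> \<sigma> (r + 1) q = a \<and> \<sigma> r p = b \<and> \<sigma> r q = c \<longrightarrow>
          (a > b \<and> b \<ge> c) \<or> (c \<ge> a \<and> a > b) \<or> (b \<ge> c \<and> c \<ge> a))) \<and>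
      (\<forall>p\<in>C. \<forall>q\<in>C. p < q \<longrightarrow>
        (\<forall>a b c d. \<sigma> (r + 1) p = a \<and> \<sigma> (r + 1) q = b \<and> \<sigma> r p = c \<and> \<sigma> r q = d \<and>
            a \<le> c \<and> b \<le> d \<longrightarrow>
          (a \<ge> b \<longrightarrow> c \<ge> d) \<and> (a < b \<longrightarrow> c \<le> d))))"

definition canonical :: "nat list \<Rightarrow> (nat \<Rightarrow> nat \<Rightarrow> nat) \<Rightarrow> bool" where
  "canonical lam \<sigma> \<longleftrightarrow> (\<forall>j\<in>{1..length lam}. canonical_rect j (block_cols lam j) \<sigma>)"

text \<open>
  \<open>nu lam N \<sigma> i j k\<close> is \<open>\<nu>\<close> with lower indices \<open>i, j\<close> and upper index \<open>k\<close>, for \<open>k \<le> N\<close>.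
  For \<open>i = j + 1\<close> it is 0, because row \<open>j + 1\<close> of \<open>\<sigma>\<^sub>j\<close> consists of zeros.
\<close>

definition nu ::
    "nat list \<Rightarrow> nat \<Rightarrow> (nat \<Rightarrow> nat \<Rightarrow> nat) \<Rightarrow> nat \<Rightarrow> nat \<Rightarrow> nat \<Rightarrow> nat" where
  "nu lam N \<sigma> i j k = card {c \<in> block_cols lam j. N + 1 - k \<le> \<sigma> i c}"

text \<open>
  In \<open>s_stat\<close> and \<open>s_sum\<close> the arguments after \<open>i j\<close> are the lower index \<open>m\<close> and then the
  upper indices (\<open>h\<close>, resp. \<open>h, k\<close>).
\<close>

definition s_stat ::
    "nat list \<Rightarrow> nat \<Rightarrow> (nat \<Rightarrow> nat \<Rightarrow> nat) \<Rightarrow> nat \<Rightarrow> nat \<Rightarrow> nat \<Rightarrow> nat \<Rightarrow> nat" where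
  "s_stat lam N \<sigma> i j m h =
    card {c \<in> block_cols lam j. \<sigma> (i + 1) c = N + 1 - h \<and> N + 1 - m \<le> \<sigma> i c}"

definition s_sum ::
    "nat list \<Rightarrow> nat \<Rightarrow> (nat \<Rightarrow> nat \<Rightarrow> nat) \<Rightarrow> nat \<Rightarrow> nat \<Rightarrow> nat \<Rightarrow> nat \<Rightarrow> nat \<Rightarrow> nat" where
  "s_sum lam N \<sigma> i j m h k = (\<Sum>a=h..k. s_stat lam N \<sigma> i j m a)"

definition D_stat :: "nat list \<Rightarrow> (nat \<Rightarrow> nat \<Rightarrow> nat) \<Rightarrow> nat \<Rightarrow> nat \<Rightarrow> int" where
  "D_stat lam \<sigma> i j =
    (\<Sum>c | c \<in> block_cols lam j \<and> \<sigma> (i + 1) c > \<sigma> i c. int (col_height lam c) - int i)"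

definition S_star :: "nat \<Rightarrow> nat \<Rightarrow> nat \<Rightarrow> nat \<Rightarrow> bool" where
  "S_star z w u v \<longleftrightarrow>
    (z = w \<and> w > v \<and> v > u) \<or>
    (u \<ge> z \<and> z = w \<and> w > v) \<or>
    (v > u \<and> u \<ge> z \<and> z = w)"

definition six_chains :: "nat \<Rightarrow> nat \<Rightarrow> nat \<Rightarrow> nat \<Rightarrow> bool" where
  "six_chains z w u v \<longleftrightarrow>
    (z > v \<and> v \<ge> w \<and> w > u) \<or>
    (u \<ge> z \<and> z > v \<and> v \<ge> w) \<or>
    (z > w \<and> w > v \<and> v > u) \<or>
    (v > u \<and> u \<ge> z \<and> z > w) \<or>
    (z > u \<and> u > v \<and> v \<ge> w) \<or>
    (v \<ge> z \<and> z > w \<and> w > u)"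

definition Q_S2 :: "nat \<Rightarrow> nat \<Rightarrow> nat \<Rightarrow> nat \<Rightarrow> nat" where
  "Q_S2 z w u v = (if S_star z w u v \<or> six_chains z w u v \<or> six_chains w z v u then 1 else 0)"

definition eta_bar :: "nat list \<Rightarrow> (nat \<Rightarrow> nat \<Rightarrow> nat) \<Rightarrow> nat \<Rightarrow> nat \<Rightarrow> nat" where
  "eta_bar lam \<sigma> i j =
    card {((i + 1, c), (i + 1, d), (i, c), (i, d)) | c d.
      c \<in> block_cols lam j \<and> d \<in> block_cols lam j \<and> c < d \<and>
      Q_S2 (\<sigma> (i + 1) c) (\<sigma> (i + 1) d) (\<sigma> i c) (\<sigma> i d) = 0}"

definition Q_triple :: "nat \<Rightarrow> nat \<Rightarrow> nat \<Rightarrow> nat" where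
  "Q_triple a b c =
    (if (a < b \<and> b < c) \<or> (b < c \<and> c < a) \<or> (c < a \<and> a < b) \<or> (a = b \<and> b \<noteq> c) then 1 else 0)"

definition quinv_bar :: "nat list \<Rightarrow> (nat \<Rightarrow> nat \<Rightarrow> nat) \<Rightarrow> nat" where
  "quinv_bar lam \<sigma> =
    card {((r + 1, c), (r, c), (r, d)) | r c d.
      1 \<le> c \<and> c < d \<and> 1 \<le> r \<and> r \<le> col_height lam d \<and> col_height lam d < col_height lam c \<and>
      Q_triple (\<sigma> (r + 1) c) (\<sigma> r c) (\<sigma> r d) = 0}"

text \<open>\<open>xi1 N s ssum nu\<close> takes the arrays \<open>s m h\<close>, \<open>ssum m h k\<close> and \<open>nu k\<close> for fixed \<open>i, j\<close>.\<close>

definition xi1 ::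
    "nat \<Rightarrow> (nat \<Rightarrow> nat \<Rightarrow> nat) \<Rightarrow> (nat \<Rightarrow> nat \<Rightarrow> nat \<Rightarrow> nat) \<Rightarrow> (nat \<Rightarrow> nat) \<Rightarrow> int" where
  "xi1 N s ssum \<nu> =
    (\<Sum>(h, k) | 1 \<le> h \<and> h \<le> k \<and> k < N.
      (int (s (k + 1) h) - int (s k h)) * (int (\<nu> k) - int (ssum k h k)))"

end

theory Submission
  imports Defs
begin

text \<open>
  For (b), take two columns \<open>(a, y)\<close> and \<open>(b, d)\<close> of \<open>\<sigma>\<^sub>j\<close>
  (upper entry, lower entry).  Canonicity makes the left-to-right order irrelevant: \<open>Q_S2 = 0\<close>
  becomes a symmetric condition on the two columns, and the four sums in (b) count the unordered
  pairs satisfying it.  Part (c) rests on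
  \<open>[Q_triple a b x = 0] = [a > b] + [b \<ge> x] - [a > x]\<close>: the first term summed over the shorter columns
  telescopes to \<open>\<lambda>\<^sub>i - \<lambda>\<^sub>j\<close>, and the other two are differences of values of \<open>\<nu>\<close>.
\<close>

section \<open>Counting\<close>

text \<open>Grouping by the value of \<open>f\<close> trades a sum over indices, weighted by fibre
  sizes, for a sum over columns. Columns whose value falls outside \<open>X\<close> have to be
  dropped, so later uses must check what the index range misses.\<close>

lemma sum_card_fibres:
  fixes g :: "'b \<Rightarrow> int"
  assumes "finite C" "finite X"
  shows "(\<Sum>x\<in>X. int (card {c \<in> C. f c = x}) * g x) = (\<Sum>c | c \<in> C \<and> f c \<in> X. g (f c))"
proof -
  have "(\<Sum>c | c \<in> C \<and> f c \<in> X. g (f c)) =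
      (\<Sum>x\<in>X. \<Sum>c\<in>{c' \<in> {c. c \<in> C \<and> f c \<in> X}. f c' = x}. g (f c))"
    using assms by (intro sum.group[symmetric]) auto
  also have "\<dots> = (\<Sum>x\<in>X. int (card {c \<in> C. f c = x}) * g x)"
  proof (intro sum.cong refl)
    fix x assume "x \<in> X"
    then have "{c' \<in> {c. c \<in> C \<and> f c \<in> X}. f c' = x} = {c \<in> C. f c = x}" by auto
    then show "(\<Sum>c\<in>{c' \<in> {c. c \<in> C \<and> f c \<in> X}. f c' = x}. g (f c)) =
        int (card {c \<in> C. f c = x}) * g x" by simp
  qed
  finally show ?thesis by simp
qed

lemma card_ordered_pairs:
  fixes S :: "'a::linorder set"
  assumes "finite S"
  shows "card {(c, d). c \<in> S \<and> d \<in> S \<and> c < d} = card S choose 2"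
  using assms
proof (induction rule: finite_linorder_max_induct)
  case empty
  then show ?case by simp
next
  case (insert m S)
  have eq: "{(c, d). c \<in> insert m S \<and> d \<in> insert m S \<and> c < d} =
      {(c, d). c \<in> S \<and> d \<in> S \<and> c < d} \<union> (\<lambda>c. (c, m)) ` S"
    using insert.hyps by auto
  have "finite {(c, d). c \<in> S \<and> d \<in> S \<and> c < d}"
    by (rule finite_subset[of _ "S \<times> S"]) (use insert.hyps in auto)
  moreover have "card ((\<lambda>c. (c, m)) ` S) = card S"
    by (rule card_image) (auto simp: inj_on_def)
  moreover have "{(c, d). c \<in> S \<and> d \<in> S \<and> c < d} \<inter> (\<lambda>c. (c, m)) ` S = {}"
    using insert.hyps by auto
  moreover have "m \<notin> S" using insert.hyps by auto
  ultimately show ?case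
    unfolding eq using insert.IH insert.hyps
    by (simp add: card_Un_disjoint numeral_2_eq_2 del: insert_iff)
qed

text \<open>Asymmetry orients each related pair in exactly one way, so pairs sorted by position
  correspond to pairs sorted by \<open>R\<close>. The right-hand side no longer mentions the order
  of the columns.\<close>

lemma card_asym_pairs:
  fixes S :: "'a::linorder set"
  assumes "finite S" and asym: "\<And>c d. R c d \<Longrightarrow> \<not> R d c"
  shows "card {(c, d). c \<in> S \<and> d \<in> S \<and> c < d \<and> (R c d \<or> R d c)} =
    (\<Sum>c\<in>S. card {d \<in> S. R c d})"
proof -
  have "bij_betw (\<lambda>(c, d). if R c d then (c, d) else (d, c))
      {(c, d). c \<in> S \<and> d \<in> S \<and> c < d \<and> (R c d \<or> R d c)} (SIGMA c:S. {d \<in> S. R c d})"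
  proof (rule bij_betw_byWitness[where f' = "\<lambda>(c, d). if c < d then (c, d) else (d, c)"],
      goal_cases)
    case 1
    then show ?case by (auto dest: asym)
  next
    case 2
    have "c \<noteq> d" if "R c d" for c d using asym that by blast
    then show ?case using asym by (fastforce simp: not_less split: if_splits)
  next
    case 3
    then show ?case by (auto split: if_splits)
  next
    case 4
    have "d < c" if "R c d" "\<not> c < d" for c d
      using asym that by (metis linorder_neqE)
    then show ?case by (auto split: if_splits)
  qed
  then have "card {(c, d). c \<in> S \<and> d \<in> S \<and> c < d \<and> (R c d \<or> R d c)} =
      card (SIGMA c:S. {d \<in> S. R c d})"
    by (rule bij_betw_same_card)
  then show ?thesis using assms(1) by simp
qed

lemma card_diff_int:
  assumes "finite A" "B \<subseteq> A"
  shows "int (card A) - int (card B) = int (card (A - B))"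
  using assms by (simp add: card_Diff_subset card_mono finite_subset of_nat_diff)

section \<open>Pairs of columns in a canonical block\<close>

text \<open>
  The condition on columns \<open>(a, y)\<close>, \<open>(b, d)\<close> read off from the right-hand side of (b): the first
  and third sums give the branch \<open>y < a\<close>, the fourth sum the other one.
\<close>

definition counted_pair :: "nat \<Rightarrow> nat \<Rightarrow> nat \<Rightarrow> nat \<Rightarrow> bool" where
  "counted_pair a y b d \<longleftrightarrow> y < d \<and> (b \<le> y \<or> y < a \<and> a \<le> b)"

lemma counted_pair_asym: "counted_pair a y b d \<Longrightarrow> \<not> counted_pair b d a y"
  by (auto simp: counted_pair_def)

text \<open>The two assumptions are conditions (I) and (II) for a left column \<open>z\<close> over
  \<open>u\<close> and a right column \<open>w\<close> over \<open>v\<close>. They exclude exactly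
  those orderings in which \<open>Q_S2\<close> would depend on which column is on the left.\<close>

lemma Q_S2_eq_0_iff:
  assumes "z = w \<Longrightarrow> (z > u \<and> u \<ge> v) \<or> (v \<ge> z \<and> z > u) \<or> (u \<ge> v \<and> v \<ge> z)"
    and "z \<le> u \<Longrightarrow> w \<le> v \<Longrightarrow> (z \<ge> w \<longrightarrow> u \<ge> v) \<and> (z < w \<longrightarrow> u \<le> v)"
  shows "Q_S2 z w u v = 0 \<longleftrightarrow> u = v \<or> counted_pair z u w v \<or> counted_pair w v z u"
proof -
  have eq: "Q_S2 z w u v = 0 \<longleftrightarrow> \<not> (S_star z w u v \<or> six_chains z w u v \<or> six_chains w z v u)"
    by (simp add: Q_S2_def)
  \<comment> \<open>A finite check over the relative orders of four numbers; moving to integers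
    turns it into plain linear arithmetic.\<close>
  show ?thesis
    unfolding eq S_star_def six_chains_def counted_pair_def using assms
    unfolding of_nat_eq_iff[where 'a = int, symmetric]
      of_nat_less_iff[where 'a = int, symmetric] of_nat_le_iff[where 'a = int, symmetric]
    by smt
qed

lemma canonical_rect_Q_S2:
  assumes "canonical_rect m C \<sigma>" "1 \<le> i" "i \<le> m" "p \<in> C" "q \<in> C" "p < q"
  shows "Q_S2 (\<sigma> (i + 1) p) (\<sigma> (i + 1) q) (\<sigma> i p) (\<sigma> i q) = 0 \<longleftrightarrow>
    \<sigma> i p = \<sigma> i q \<or> counted_pair (\<sigma> (i + 1) p) (\<sigma> i p) (\<sigma> (i + 1) q) (\<sigma> i q)
      \<or> counted_pair (\<sigma> (i + 1) q) (\<sigma> i q) (\<sigma> (i + 1) p) (\<sigma> i p)"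
proof (rule Q_S2_eq_0_iff)
  have i: "i \<in> {1..m}" using assms by simp
  show "\<sigma> (i + 1) p > \<sigma> i p \<and> \<sigma> i p \<ge> \<sigma> i q \<or> \<sigma> i q \<ge> \<sigma> (i + 1) p \<and> \<sigma> (i + 1) p > \<sigma> i p \<or>
      \<sigma> i p \<ge> \<sigma> i q \<and> \<sigma> i q \<ge> \<sigma> (i + 1) p" if "\<sigma> (i + 1) p = \<sigma> (i + 1) q"
    using assms(1)[unfolded canonical_rect_def, THEN bspec, OF i, THEN conjunct1,
      THEN bspec, OF assms(4), THEN bspec, OF assms(5), THEN mp, OF assms(6)] that
    by metis
  show "(\<sigma> (i + 1) p \<ge> \<sigma> (i + 1) q \<longrightarrow> \<sigma> i p \<ge> \<sigma> i q) \<and> (\<sigma> (i + 1) p < \<sigma> (i + 1) q \<longrightarrow> \<sigma> i p \<le> \<sigma> i q)"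
    if "\<sigma> (i + 1) p \<le> \<sigma> i p" "\<sigma> (i + 1) q \<le> \<sigma> i q"
    using assms(1)[unfolded canonical_rect_def, THEN bspec, OF i, THEN conjunct2,
      THEN bspec, OF assms(4), THEN bspec, OF assms(5), THEN mp, OF assms(6)] that
    by metis
qed

lemma eta_bar_eq_counted_pairs:
  assumes can: "canonical_rect j (block_cols lam j) \<sigma>" and i: "1 \<le> i" "i \<le> j"
    and fin: "finite (block_cols lam j)"
  shows "eta_bar lam \<sigma> i j =
    card {(c, d). c \<in> block_cols lam j \<and> d \<in> block_cols lam j \<and> c < d \<and> \<sigma> i c = \<sigma> i d} +
    (\<Sum>c\<in>block_cols lam j. card {d \<in> block_cols lam j.
       counted_pair (\<sigma> (i + 1) c) (\<sigma> i c) (\<sigma> (i + 1) d) (\<sigma> i d)})"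
proof -
  define C where "C = block_cols lam j"
  let ?R = "\<lambda>c d. counted_pair (\<sigma> (i + 1) c) (\<sigma> i c) (\<sigma> (i + 1) d) (\<sigma> i d)"
  let ?E = "{(c, d). c \<in> C \<and> d \<in> C \<and> c < d \<and> \<sigma> i c = \<sigma> i d}"
  let ?G = "{(c, d). c \<in> C \<and> d \<in> C \<and> c < d \<and> (?R c d \<or> ?R d c)}"
  have finC: "finite C" using fin by (simp add: C_def)
  have fins: "finite ?E" "finite ?G"
    by (rule finite_subset[of _ "C \<times> C"]; use finC in auto)+
  \<comment> \<open>\<open>counted_pair\<close> demands strictly increasing lower entries, which
    rules out equal ones.\<close>
  have disj: "?E \<inter> ?G = {}" by (auto simp: counted_pair_def)
  have "eta_bar lam \<sigma> i j = card ((\<lambda>(c, d). ((i + 1, c), (i + 1, d), (i, c), (i, d))) ` (?E \<union> ?G))"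
    unfolding eta_bar_def
    by (rule arg_cong[where f = card])
      (use canonical_rect_Q_S2[OF can i, folded C_def] in \<open>auto simp: C_def[symmetric] image_iff\<close>)
  also have "\<dots> = card (?E \<union> ?G)"
    by (rule card_image) (auto simp: inj_on_def)
  also have "\<dots> = card ?E + card ?G"
    using fins disj by (simp add: card_Un_disjoint)
  also have "card ?G = (\<Sum>c\<in>C. card {d \<in> C. ?R c d})"
    by (rule card_asym_pairs[OF finC]) (rule counted_pair_asym)
  finally show ?thesis by (simp add: C_def)
qed

section \<open>The counts as cardinalities of sets of columns\<close>

text \<open>Isolates the bounds on two adjacent rows of one block. Only row \<open>i\<close> is
  bounded below by 1, because row \<open>i + 1\<close> is the zero row when
  \<open>i = j\<close>.\<close>

locale column_block =
  fixes lam :: "nat list" and N :: nat and \<sigma> :: "nat \<Rightarrow> nat \<Rightarrow> nat" and i j :: nat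
  assumes lower: "c \<in> block_cols lam j \<Longrightarrow> 1 \<le> \<sigma> i c \<and> \<sigma> i c \<le> N"
    and upper: "c \<in> block_cols lam j \<Longrightarrow> \<sigma> (i + 1) c \<le> N"
begin

abbreviation "C \<equiv> block_cols lam j"
abbreviation "s \<equiv> s_stat lam N \<sigma> i j"
abbreviation "ss \<equiv> s_sum lam N \<sigma> i j"
abbreviation "\<nu> \<equiv> nu lam N \<sigma> i j"

lemma finite_C: "finite C"
  by (rule finite_subset[of _ "{..part lam j}"]) (auto simp: block_cols_def)

text \<open>Supplies the entry bounds when sets of columns are compared; without them the truncated
  subtractions \<open>N + 1 - x\<close> could not be inverted.\<close>

lemma block_set_eqI:
  assumes "A \<subseteq> C" "B \<subseteq> C"
    and "\<And>c. c \<in> C \<Longrightarrow> 1 \<le> \<sigma> i c \<Longrightarrow> \<sigma> i c \<le> N \<Longrightarrow> \<sigma> (i + 1) c \<le> N \<Longrightarrow> c \<in> A \<longleftrightarrow> c \<in> B"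
  shows "A = B"
  using assms lower upper by blast

text \<open>The two sets are nested, and passing from \<open>k\<close> to \<open>k + 1\<close>
  admits just the lower entry \<open>N - k\<close>. The pair form makes the count a fibre, ready for
  \<open>sum_card_fibres\<close>.\<close>

lemma s_diff:
  assumes "k < N" "h \<le> k"
  shows "int (s (k + 1) h) - int (s k h) = int (card {c \<in> C. (N + 1 - \<sigma> (i + 1) c, N - \<sigma> i c) = (h, k)})"
proof -
  have "int (s (k + 1) h) - int (s k h) =
      int (card ({c \<in> C. \<sigma> (i + 1) c = N + 1 - h \<and> N + 1 - (k + 1) \<le> \<sigma> i c} -
                 {c \<in> C. \<sigma> (i + 1) c = N + 1 - h \<and> N + 1 - k \<le> \<sigma> i c}))"
    unfolding s_stat_def using finite_C by (intro card_diff_int) auto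
  also have "{c \<in> C. \<sigma> (i + 1) c = N + 1 - h \<and> N + 1 - (k + 1) \<le> \<sigma> i c} -
      {c \<in> C. \<sigma> (i + 1) c = N + 1 - h \<and> N + 1 - k \<le> \<sigma> i c} =
      {c \<in> C. (N + 1 - \<sigma> (i + 1) c, N - \<sigma> i c) = (h, k)}"
    by (rule block_set_eqI) (use assms in auto)
  finally show ?thesis .
qed

lemma ss_card:
  assumes "k \<le> N" "1 \<le> h"
  shows "ss m h k = card {c \<in> C. N + 1 - k \<le> \<sigma> (i + 1) c \<and> \<sigma> (i + 1) c \<le> N + 1 - h \<and> N + 1 - m \<le> \<sigma> i c}"
proof -
  let ?C = "{c \<in> C. N + 1 - m \<le> \<sigma> i c}"
  have "int (ss m h k) = (\<Sum>a\<in>{h..k}. int (card {c \<in> ?C. N + 1 - \<sigma> (i + 1) c = a}) * 1)"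
    unfolding s_sum_def s_stat_def of_nat_sum
  proof (intro sum.cong refl)
    fix a assume a: "a \<in> {h..k}"
    have "{c \<in> C. \<sigma> (i + 1) c = N + 1 - a \<and> N + 1 - m \<le> \<sigma> i c} =
        {c \<in> ?C. N + 1 - \<sigma> (i + 1) c = a}"
      by (rule block_set_eqI) (use a assms in auto)
    then show "int (card {c \<in> C. \<sigma> (i + 1) c = N + 1 - a \<and> N + 1 - m \<le> \<sigma> i c}) =
        int (card {c \<in> ?C. N + 1 - \<sigma> (i + 1) c = a}) * 1" by simp
  qed
  also have "\<dots> = (\<Sum>c | c \<in> ?C \<and> N + 1 - \<sigma> (i + 1) c \<in> {h..k}. 1)"
    using finite_C by (intro sum_card_fibres) auto
  also have "\<dots> = int (card {c. c \<in> ?C \<and> N + 1 - \<sigma> (i + 1) c \<in> {h..k}})" by simp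
  also have "{c. c \<in> ?C \<and> N + 1 - \<sigma> (i + 1) c \<in> {h..k}} =
      {c \<in> C. N + 1 - k \<le> \<sigma> (i + 1) c \<and> \<sigma> (i + 1) c \<le> N + 1 - h \<and> N + 1 - m \<le> \<sigma> i c}"
    by (rule block_set_eqI) (use assms in auto)
  finally show ?thesis by simp
qed

lemma nu_minus_ss:
  assumes "k \<le> N" "1 \<le> h"
  shows "int (\<nu> m) - int (ss m h k) =
    int (card {c \<in> C. N + 1 - m \<le> \<sigma> i c \<and> \<not> (N + 1 - k \<le> \<sigma> (i + 1) c \<and> \<sigma> (i + 1) c \<le> N + 1 - h)})"
proof -
  let ?L = "{c \<in> C. N + 1 - m \<le> \<sigma> i c}"
  let ?S = "{c \<in> C. N + 1 - k \<le> \<sigma> (i + 1) c \<and> \<sigma> (i + 1) c \<le> N + 1 - h \<and> N + 1 - m \<le> \<sigma> i c}"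
  have "int (\<nu> m) - int (ss m h k) = int (card (?L - ?S))"
    unfolding nu_def ss_card[OF assms] using finite_C by (intro card_diff_int) auto
  also have "?L - ?S = {c \<in> C. N + 1 - m \<le> \<sigma> i c \<and>
      \<not> (N + 1 - k \<le> \<sigma> (i + 1) c \<and> \<sigma> (i + 1) c \<le> N + 1 - h)}"
    by auto
  finally show ?thesis .
qed

lemma nu_diff:
  assumes "1 \<le> k" "k \<le> N"
  shows "int (\<nu> k) - int (\<nu> (k - 1)) = int (card {c \<in> C. N + 1 - \<sigma> i c = k})"
proof -
  have "int (\<nu> k) - int (\<nu> (k - 1)) =
      int (card ({c \<in> C. N + 1 - k \<le> \<sigma> i c} - {c \<in> C. N + 1 - (k - 1) \<le> \<sigma> i c}))"
    unfolding nu_def using finite_C by (intro card_diff_int) auto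
  also have "{c \<in> C. N + 1 - k \<le> \<sigma> i c} - {c \<in> C. N + 1 - (k - 1) \<le> \<sigma> i c} =
      {c \<in> C. N + 1 - \<sigma> i c = k}"
    by (rule block_set_eqI) (use assms in auto)
  finally show ?thesis .
qed

text \<open>The subtracted \<open>ss\<close> leaves upper entries at most \<open>N - k\<close>, and
  the step from \<open>k\<close> to \<open>k + 1\<close> fixes the lower entry as
  \<open>N - k\<close>. Together these say that the column has no descent.\<close>

lemma nu_ss_diff:
  assumes "1 \<le> k" "k < N"
  shows "int (\<nu> (k + 1)) - int (ss (k + 1) 1 k) - int (\<nu> k) + int (ss k 1 k) =
    int (card {c \<in> {c \<in> C. \<sigma> (i + 1) c \<le> \<sigma> i c}. N - \<sigma> i c = k})"
proof -
  let ?A = "\<lambda>m. {c \<in> C. N + 1 - m \<le> \<sigma> i c \<and> \<not> (N + 1 - k \<le> \<sigma> (i + 1) c \<and> \<sigma> (i + 1) c \<le> N + 1 - 1)}"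
  have "int (\<nu> (k + 1)) - int (ss (k + 1) 1 k) - int (\<nu> k) + int (ss k 1 k) =
      int (card (?A (k + 1))) - int (card (?A k))"
    using assms nu_minus_ss[of k 1 "k + 1"] nu_minus_ss[of k 1 k] by linarith
  also have "\<dots> = int (card (?A (k + 1) - ?A k))"
    using finite_C by (intro card_diff_int) auto
  also have "?A (k + 1) - ?A k = {c \<in> {c \<in> C. \<sigma> (i + 1) c \<le> \<sigma> i c}. N - \<sigma> i c = k}"
    by (rule block_set_eqI) (use assms in auto)
  finally show ?thesis .
qed

text \<open>For each \<open>k\<close> the difference keeps the columns with upper entry
  \<open>N + 1 - k\<close> and a smaller lower entry. The count serves both (a) and (c).\<close>

lemma descents_card:
  "(\<Sum>k=1..N-1. int (s N k) - int (s k k)) = int (card {c \<in> C. \<sigma> i c < \<sigma> (i + 1) c})"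
proof -
  let ?D = "{c \<in> C. \<sigma> i c < \<sigma> (i + 1) c}"
  have "(\<Sum>k=1..N-1. int (s N k) - int (s k k)) =
      (\<Sum>k\<in>{1..N-1}. int (card {c \<in> ?D. N + 1 - \<sigma> (i + 1) c = k}) * 1)"
  proof (intro sum.cong refl)
    fix k assume k: "k \<in> {1..N-1}"
    have "int (s N k) - int (s k k) =
        int (card ({c \<in> C. \<sigma> (i + 1) c = N + 1 - k \<and> N + 1 - N \<le> \<sigma> i c} -
                   {c \<in> C. \<sigma> (i + 1) c = N + 1 - k \<and> N + 1 - k \<le> \<sigma> i c}))"
      unfolding s_stat_def using finite_C k by (intro card_diff_int) auto
    also have "{c \<in> C. \<sigma> (i + 1) c = N + 1 - k \<and> N + 1 - N \<le> \<sigma> i c} -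
        {c \<in> C. \<sigma> (i + 1) c = N + 1 - k \<and> N + 1 - k \<le> \<sigma> i c} =
        {c \<in> ?D. N + 1 - \<sigma> (i + 1) c = k}"
      by (rule block_set_eqI) (use k in auto)
    finally show "int (s N k) - int (s k k) = int (card {c \<in> ?D. N + 1 - \<sigma> (i + 1) c = k}) * 1"
      by simp
  qed
  also have "\<dots> = (\<Sum>c | c \<in> ?D \<and> N + 1 - \<sigma> (i + 1) c \<in> {1..N-1}. 1)"
    using finite_C by (intro sum_card_fibres) auto
  also have "\<dots> = int (card {c. c \<in> ?D \<and> N + 1 - \<sigma> (i + 1) c \<in> {1..N-1}})" by simp
  \<comment> \<open>The upper entry of a descent is at least 2, since the lower one is positive;
    hence stopping at \<open>N - 1\<close> loses nothing.\<close>
  also have "{c. c \<in> ?D \<and> N + 1 - \<sigma> (i + 1) c \<in> {1..N-1}} = ?D"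
    by (rule block_set_eqI) auto
  finally show ?thesis .
qed

section \<open>The four sums of (b) as counts of pairs of columns\<close>

lemma equal_lower_pairs:
  "int (card {(c, d). c \<in> C \<and> d \<in> C \<and> c < d \<and> \<sigma> i c = \<sigma> i d}) =
    (\<Sum>k=1..N. int ((\<nu> k - \<nu> (k - 1)) choose 2))"
proof -
  let ?F = "\<lambda>k. {c \<in> C. N + 1 - \<sigma> i c = k}"
  let ?P = "\<lambda>k. {(c, d). c \<in> ?F k \<and> d \<in> ?F k \<and> c < d}"
  have fin: "finite (?P k)" for k
    by (rule finite_subset[of _ "C \<times> C"]) (use finite_C in auto)
  have un: "{(c, d). c \<in> C \<and> d \<in> C \<and> c < d \<and> \<sigma> i c = \<sigma> i d} = (\<Union>k\<in>{1..N}. ?P k)"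
  proof -
    have "N + 1 - \<sigma> i c \<in> {1..N}" if "c \<in> C" for c using lower[OF that] by auto
    moreover have "\<sigma> i c = \<sigma> i d" if "c \<in> C" "d \<in> C" "N + 1 - \<sigma> i c = N + 1 - \<sigma> i d" for c d
      using lower[OF that(1)] lower[OF that(2)] that(3) by linarith
    ultimately show ?thesis by fastforce
  qed
  have "card {(c, d). c \<in> C \<and> d \<in> C \<and> c < d \<and> \<sigma> i c = \<sigma> i d} = (\<Sum>k=1..N. card (?P k))"
    unfolding un by (rule card_UN_disjoint) (use fin in auto)
  also have "\<dots> = (\<Sum>k=1..N. (\<nu> k - \<nu> (k - 1)) choose 2)"
  proof (intro sum.cong refl)
    fix k assume "k \<in> {1..N}"
    \<comment> \<open>By \<open>nu_diff\<close> the integer difference is a cardinality, so the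
      natural subtraction here does not truncate.\<close>
    then have "card (?F k) = \<nu> k - \<nu> (k - 1)" using nu_diff[of k] by auto
    then show "card (?P k) = (\<nu> k - \<nu> (k - 1)) choose 2"
      using card_ordered_pairs[of "?F k"] finite_C by simp
  qed
  finally show ?thesis by simp
qed

text \<open>The first and third sums of (b) share the factor \<open>s (k + 1) h - s k h\<close>,
  which counts descents with upper entry \<open>N + 1 - h\<close> and lower entry
  \<open>N - k\<close>. The combined cofactor is the number of partners of such a column.\<close>

lemma descent_pairs:
  "xi1 N s ss \<nu> + (\<Sum>k=1..N-1. \<Sum>h=1..k. (int (s (k + 1) h) - int (s k h)) * int (s k h)) =
    (\<Sum>c | c \<in> C \<and> \<sigma> i c < \<sigma> (i + 1) c.
      int (card {d \<in> C. counted_pair (\<sigma> (i + 1) c) (\<sigma> i c) (\<sigma> (i + 1) d) (\<sigma> i d)}))"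
proof -
  let ?X = "{(h, k). 1 \<le> h \<and> h \<le> k \<and> k < N}"
  let ?f = "\<lambda>c. (N + 1 - \<sigma> (i + 1) c, N - \<sigma> i c)"
  define g where "g = (\<lambda>(h, k). int (\<nu> k) - int (ss k h k) + int (s k h))"
  have finX: "finite ?X" by (rule finite_subset[of _ "{..N} \<times> {..N}"]) auto
  have "(\<Sum>k=1..N-1. \<Sum>h=1..k. (int (s (k + 1) h) - int (s k h)) * int (s k h)) =
      (\<Sum>(k, h)\<in>(SIGMA k:{1..N-1}. {1..k}). (int (s (k + 1) h) - int (s k h)) * int (s k h))"
    by (rule sum.Sigma) auto
  also have "\<dots> = (\<Sum>(h, k)\<in>?X. (int (s (k + 1) h) - int (s k h)) * int (s k h))"
    by (rule sum.reindex_bij_witness[where i = prod.swap and j = prod.swap]) auto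
  finally have "xi1 N s ss \<nu> + (\<Sum>k=1..N-1. \<Sum>h=1..k. (int (s (k + 1) h) - int (s k h)) * int (s k h)) =
      (\<Sum>x\<in>?X. (int (s (snd x + 1) (fst x)) - int (s (snd x) (fst x))) * g x)"
    unfolding xi1_def g_def sum.distrib[symmetric] case_prod_unfold
    by (simp add: distrib_left sum.distrib)
  also have "\<dots> = (\<Sum>x\<in>?X. int (card {c \<in> C. ?f c = x}) * g x)"
  proof (intro sum.cong refl, goal_cases)
    case (1 x)
    have "int (s (snd x + 1) (fst x)) - int (s (snd x) (fst x)) =
        int (card {c \<in> C. ?f c = (fst x, snd x)})"
      by (rule s_diff) (use 1 in auto)
    then show ?case by simp
  qed
  also have "\<dots> = (\<Sum>c | c \<in> C \<and> ?f c \<in> ?X. g (?f c))"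
    by (rule sum_card_fibres[OF finite_C finX])
  also have "\<dots> = (\<Sum>c | c \<in> C \<and> \<sigma> i c < \<sigma> (i + 1) c.
      int (card {d \<in> C. counted_pair (\<sigma> (i + 1) c) (\<sigma> i c) (\<sigma> (i + 1) d) (\<sigma> i d)}))"
  proof (intro sum.cong)
    \<comment> \<open>With \<open>h = N + 1 - a\<close> and \<open>k = N - y\<close>, the condition
      \<open>h \<le> k\<close> means \<open>y < a\<close>; the other two bounds say
      \<open>a \<le> N\<close> and \<open>1 \<le> y\<close>.\<close>
    show "{c. c \<in> C \<and> ?f c \<in> ?X} = {c. c \<in> C \<and> \<sigma> i c < \<sigma> (i + 1) c}"
      by (rule block_set_eqI) auto
  next
    fix c assume "c \<in> {c. c \<in> C \<and> \<sigma> i c < \<sigma> (i + 1) c}"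
    then have c: "c \<in> C" "\<sigma> i c < \<sigma> (i + 1) c" by auto
    let ?h = "N + 1 - \<sigma> (i + 1) c" and ?k = "N - \<sigma> i c"
    note b = lower[OF c(1)] upper[OF c(1)]
    let ?V = "{d \<in> C. N + 1 - ?k \<le> \<sigma> i d \<and>
      \<not> (N + 1 - ?k \<le> \<sigma> (i + 1) d \<and> \<sigma> (i + 1) d \<le> N + 1 - ?h)}"
    let ?W = "{d \<in> C. \<sigma> (i + 1) d = N + 1 - ?h \<and> N + 1 - ?k \<le> \<sigma> i d}"
    have "g (?f c) = int (card ?V) + int (card ?W)"
      using nu_minus_ss[of ?k ?h ?k] b by (simp add: g_def s_stat_def)
    also have "\<dots> = int (card (?V \<union> ?W))"
      using b c finite_C by (subst card_Un_disjoint) auto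
    \<comment> \<open>Write \<open>a\<close> over \<open>y\<close> for column \<open>c\<close>. Both
      sets require a lower entry above \<open>y\<close>; \<open>?V\<close> takes upper entries
      outside \<open>y + 1, ..., a\<close>, and \<open>?W\<close> puts back the value
      \<open>a\<close>. What remains is an upper entry at most \<open>y\<close> or at least
      \<open>a\<close>.\<close>
    also have "?V \<union> ?W = {d \<in> C. counted_pair (\<sigma> (i + 1) c) (\<sigma> i c) (\<sigma> (i + 1) d) (\<sigma> i d)}"
      using b c by (auto simp: counted_pair_def)
    finally show "g (?f c) =
      int (card {d \<in> C. counted_pair (\<sigma> (i + 1) c) (\<sigma> i c) (\<sigma> (i + 1) d) (\<sigma> i d)})" .
  qed
  finally show ?thesis .
qed

text \<open>For a column with no descent only the branch \<open>b \<le> y\<close> of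
  \<open>counted_pair\<close> can hold. At \<open>k = N - y\<close>, the factor
  \<open>\<nu> k - ss k 1 k\<close> counts the columns with lower entry above \<open>y\<close> and
  upper entry at most \<open>y\<close>.\<close>

lemma nondescent_pairs:
  "(\<Sum>k=1..N-1. (int (\<nu> (k + 1)) - int (ss (k + 1) 1 k) - int (\<nu> k) + int (ss k 1 k))
      * (int (\<nu> k) - int (ss k 1 k))) =
    (\<Sum>c | c \<in> C \<and> \<sigma> (i + 1) c \<le> \<sigma> i c.
      int (card {d \<in> C. counted_pair (\<sigma> (i + 1) c) (\<sigma> i c) (\<sigma> (i + 1) d) (\<sigma> i d)}))"
proof -
  let ?A = "{c \<in> C. \<sigma> (i + 1) c \<le> \<sigma> i c}"
  let ?K = "\<lambda>c. {d \<in> C. counted_pair (\<sigma> (i + 1) c) (\<sigma> i c) (\<sigma> (i + 1) d) (\<sigma> i d)}"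
  have "(\<Sum>k=1..N-1. (int (\<nu> (k + 1)) - int (ss (k + 1) 1 k) - int (\<nu> k) + int (ss k 1 k))
      * (int (\<nu> k) - int (ss k 1 k))) =
      (\<Sum>k\<in>{1..N-1}. int (card {c \<in> ?A. N - \<sigma> i c = k}) * (int (\<nu> k) - int (ss k 1 k)))"
    by (intro sum.cong refl) (subst nu_ss_diff, auto)
  also have "\<dots> = (\<Sum>c | c \<in> ?A \<and> N - \<sigma> i c \<in> {1..N-1}.
      int (\<nu> (N - \<sigma> i c)) - int (ss (N - \<sigma> i c) 1 (N - \<sigma> i c)))"
    using finite_C by (intro sum_card_fibres) auto
  also have "\<dots> = (\<Sum>c | c \<in> ?A \<and> N - \<sigma> i c \<in> {1..N-1}. int (card (?K c)))"
  proof (intro sum.cong refl)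
    fix c assume c: "c \<in> {c. c \<in> ?A \<and> N - \<sigma> i c \<in> {1..N-1}}"
    let ?k = "N - \<sigma> i c"
    have "{d \<in> C. N + 1 - ?k \<le> \<sigma> i d \<and> \<not> (N + 1 - ?k \<le> \<sigma> (i + 1) d \<and> \<sigma> (i + 1) d \<le> N + 1 - 1)} = ?K c"
      using c by (auto simp: counted_pair_def dest: upper)
    then show "int (\<nu> ?k) - int (ss ?k 1 ?k) = int (card (?K c))"
      using nu_minus_ss[of ?k 1 ?k] by simp
  qed
  also have "\<dots> = (\<Sum>c\<in>?A. int (card (?K c)))"
  \<comment> \<open>The index range misses only \<open>k = 0\<close>, that is, lower entry
    \<open>N\<close>; no column has a larger lower entry, so these terms vanish.\<close>
  proof (rule sum.mono_neutral_left)
    show "\<forall>c\<in>?A - {c. c \<in> ?A \<and> N - \<sigma> i c \<in> {1..N-1}}. int (card (?K c)) = 0"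
    proof
      fix c assume c: "c \<in> ?A - {c. c \<in> ?A \<and> N - \<sigma> i c \<in> {1..N-1}}"
      then have "\<sigma> i c = N" using lower[of c] by auto
      then have empty: "?K c = {}" by (auto simp: counted_pair_def dest: lower)
      show "int (card (?K c)) = 0" unfolding empty by simp
    qed
  qed (use finite_C in auto)
  finally show ?thesis by simp
qed

lemma eta_bar_formula:
  assumes "canonical_rect j C \<sigma>" "1 \<le> i" "i \<le> j"
  shows "int (eta_bar lam \<sigma> i j) =
     xi1 N s ss \<nu>
     + (\<Sum>k=1..N. int ((\<nu> k - \<nu> (k - 1)) choose 2))
     + (\<Sum>k=1..N-1. \<Sum>h=1..k. (int (s (k + 1) h) - int (s k h)) * int (s k h))
     + (\<Sum>k=1..N-1.
         (int (\<nu> (k + 1)) - int (ss (k + 1) 1 k) - int (\<nu> k) + int (ss k 1 k))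
         * (int (\<nu> k) - int (ss k 1 k)))"
proof -
  let ?K = "\<lambda>c. int (card {d \<in> C. counted_pair (\<sigma> (i + 1) c) (\<sigma> i c) (\<sigma> (i + 1) d) (\<sigma> i d)})"
  have "(\<Sum>c\<in>C. ?K c) = (\<Sum>c | c \<in> C \<and> \<sigma> i c < \<sigma> (i + 1) c. ?K c)
      + (\<Sum>c | c \<in> C \<and> \<sigma> (i + 1) c \<le> \<sigma> i c. ?K c)"
    using finite_C by (subst sum.union_disjoint[symmetric]) (auto intro!: sum.cong)
  then show ?thesis
    using eta_bar_eq_counted_pairs[OF assms finite_C] equal_lower_pairs descent_pairs nondescent_pairs
    by simp
qed

end

section \<open>Columns of a partition\<close>

lemma part_antimono:
  assumes "is_partition lam" "1 \<le> i" "i \<le> i'"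
  shows "part lam i' \<le> part lam i"
proof (cases "i' \<le> length lam \<and> i < i'")
  case True
  then have "lam ! (i - 1) \<ge> lam ! (i' - 1)"
    using assms unfolding is_partition_def by (intro sorted_wrt_nth_less[of "(\<ge>)" lam]) auto
  then show ?thesis using True assms by (simp add: part_def)
next
  case False
  then show ?thesis using assms by (cases "i = i'") (auto simp: part_def)
qed

lemma card_block_cols:
  assumes "is_partition lam" "1 \<le> j"
  shows "int (card (block_cols lam j)) = int (part lam j) - int (part lam (j + 1))"
proof -
  have "block_cols lam j = {part lam (j + 1)<..part lam j}" by (auto simp: block_cols_def)
  then show ?thesis using part_antimono[OF assms, of "j + 1"] by simp
qed

lemma column_cells:
  assumes "is_partition lam" "1 \<le> j" "j \<le> length lam" "c \<in> block_cols lam j"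
  shows "{r. (r, c) \<in> cells lam} = {1..j}"
proof (intro set_eqI iffI)
  fix r assume r: "r \<in> {1..j}"
  then show "r \<in> {r. (r, c) \<in> cells lam}"
    using assms part_antimono[OF assms(1), of r j] by (auto simp: cells_def block_cols_def)
next
  fix r assume r: "r \<in> {r. (r, c) \<in> cells lam}"
  then have "\<not> j + 1 \<le> r"
    using assms part_antimono[OF assms(1), of "j + 1" r] by (auto simp: cells_def block_cols_def)
  then show "r \<in> {1..j}" using r by (auto simp: cells_def)
qed

lemma col_height_block:
  assumes "is_partition lam" "1 \<le> j" "j \<le> length lam" "c \<in> block_cols lam j"
  shows "col_height lam c = j"
  using column_cells[OF assms] by (simp add: col_height_def)

text \<open>Converse to \<open>col_height_block\<close>. Quinv triples are defined through column
  heights while the formula sums over blocks, so both directions are required.\<close>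

lemma block_col_height:
  assumes "is_partition lam" "1 \<le> col_height lam c"
  shows "c \<in> block_cols lam (col_height lam c)" "col_height lam c \<le> length lam"
proof -
  let ?R = "{r. (r, c) \<in> cells lam}"
  have "?R \<noteq> {}" using assms(2) unfolding col_height_def by (metis card.empty not_one_le_zero)
  moreover have fin: "finite ?R" by (rule finite_subset[of _ "{..length lam}"]) (auto simp: cells_def)
  ultimately have R: "Max ?R \<in> ?R" by (rule Max_in[rotated])
  define m where "m = Max ?R"
  have m: "1 \<le> m" "m \<le> length lam" "1 \<le> c" "c \<le> part lam m"
    using R by (auto simp: m_def cells_def)
  have "\<not> c \<le> part lam (m + 1)"
  proof
    assume "c \<le> part lam (m + 1)"
    \<comment> \<open>\<open>part\<close> is 0 beyond the last row, so
      \<open>1 \<le> c \<le> part lam (m + 1)\<close> already puts row \<open>m + 1\<close> inside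
      the diagram.\<close>
    then have "m + 1 \<in> ?R" using m by (auto simp: cells_def part_def split: if_splits)
    then have "m + 1 \<le> m" unfolding m_def using fin by (rule Max_ge[rotated])
    then show False by simp
  qed
  then have b: "c \<in> block_cols lam m" using m by (simp add: block_cols_def)
  then have "col_height lam c = m" using col_height_block[OF assms(1)] m by simp
  then show "c \<in> block_cols lam (col_height lam c)" "col_height lam c \<le> length lam"
    using b m by auto
qed

section \<open>Bounds on the entries of a filling\<close>

lemma finite_entries: "finite (entries lam \<sigma>)"
proof -
  have "part lam r \<le> Max (insert 0 (set lam))" for r by (auto simp: part_def)
  then have "cells lam \<subseteq> {..length lam} \<times> {..Max (insert 0 (set lam))}"
    by (auto simp: cells_def intro: order_trans)
  then show ?thesis
    unfolding entries_def by (intro finite_imageI) (auto intro: finite_subset)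
qed

lemma filling_pos_iff: "\<sigma> \<in> fillings lam \<Longrightarrow> 0 < \<sigma> r c \<longleftrightarrow> (r, c) \<in> cells lam"
  unfolding fillings_def by (metis (mono_tags, lifting) less_irrefl mem_Collect_eq)

lemma filling_le_Max:
  assumes "\<sigma> \<in> fillings lam"
  shows "\<sigma> r c \<le> Max (entries lam \<sigma>)"
proof (cases "(r, c) \<in> cells lam")
  case True
  then have "\<sigma> r c \<in> entries lam \<sigma>"
    unfolding entries_def by (auto intro!: image_eqI[of _ _ "(r, c)"])
  then show ?thesis by (rule Max_ge[OF finite_entries])
next
  case False
  then show ?thesis using filling_pos_iff[OF assms, of r c] by simp
qed

lemma column_block_fillings:
  assumes "is_partition lam" "\<sigma> \<in> fillings lam" "N = Max (entries lam \<sigma>)"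
    "1 \<le> i" "i \<le> j" "j \<le> length lam"
  shows "column_block lam N \<sigma> i j"
proof
  have cell: "(i, c) \<in> cells lam" if "c \<in> block_cols lam j" for c
    using column_cells[OF assms(1) _ assms(6) that] assms(4,5) by auto
  then show "1 \<le> \<sigma> i c \<and> \<sigma> i c \<le> N" if "c \<in> block_cols lam j" for c
    using that filling_pos_iff[OF assms(2), of i c] filling_le_Max[OF assms(2), of i c] assms(3)
    by (simp add: Suc_le_eq)
  show "\<sigma> (i + 1) c \<le> N" for c
    using filling_le_Max[OF assms(2)] assms(3) by simp
qed

section \<open>Quinv triples\<close>

lemma Q_triple_eq_0:
  "(of_bool (Q_triple a b x = 0) :: int) = of_bool (b < a) + of_bool (x \<le> b) - of_bool (x < a)"
  by (auto simp: Q_triple_def)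

text \<open>A triple is indexed by its row \<open>i\<close>, the height \<open>j\<close> of the
  shorter column \<open>d\<close> and the height \<open>l\<close> of the taller column
  \<open>c\<close>. Heights decrease from left to right, so \<open>j < l\<close> already forces
  \<open>c < d\<close>.\<close>

lemma quinv_bar_sum:
  assumes "is_partition lam"
  shows "int (quinv_bar lam \<sigma>) =
    (\<Sum>(i, j) | 1 \<le> i \<and> i \<le> j \<and> j \<le> length lam. \<Sum>l=j+1..length lam.
      \<Sum>d\<in>block_cols lam j. \<Sum>c\<in>block_cols lam l. of_bool (Q_triple (\<sigma> (i + 1) c) (\<sigma> i c) (\<sigma> i d) = 0))"
proof -
  let ?n = "length lam"
  let ?I = "{(i, j). 1 \<le> i \<and> i \<le> j \<and> j \<le> ?n}"
  let ?Q = "\<lambda>i c d. Q_triple (\<sigma> (i + 1) c) (\<sigma> i c) (\<sigma> i d) = 0"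
  let ?T = "SIGMA p:?I. SIGMA l:{snd p+1..?n}. SIGMA d:block_cols lam (snd p). {c \<in> block_cols lam l. ?Q (fst p) c d}"
  have finI: "finite ?I" by (rule finite_subset[of _ "{..?n} \<times> {..?n}"]) auto
  have finB: "finite (block_cols lam j)" for j
    by (rule finite_subset[of _ "{..part lam j}"]) (auto simp: block_cols_def)
  have lt: "c < d" if "d \<in> block_cols lam j" "c \<in> block_cols lam l" "1 \<le> j" "j < l" for c d j l
    using that part_antimono[OF assms, of "j + 1" l] by (auto simp: block_cols_def)
  have "quinv_bar lam \<sigma> = card ((\<lambda>((i, j), l, d, c). ((i + 1, c), (i, c), (i, d))) ` ?T)"
    unfolding quinv_bar_def
  proof (rule arg_cong[where f = card], intro set_eqI iffI, goal_cases)
    case (1 x)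
    then obtain r c d where x: "x = ((r + 1, c), (r, c), (r, d))" and h: "1 \<le> c" "c < d" "1 \<le> r"
      "r \<le> col_height lam d" "col_height lam d < col_height lam c" "?Q r c d" by auto
    have "((r, col_height lam d), col_height lam c, d, c) \<in> ?T"
      using h block_col_height[OF assms, of c] block_col_height[OF assms, of d] by auto
    then show ?case unfolding x by (rule rev_image_eqI) simp
  next
    case (2 x)
    then obtain i j l d c where x: "x = ((i + 1, c), (i, c), (i, d))" and h: "1 \<le> i" "i \<le> j" "j \<le> ?n"
      "j + 1 \<le> l" "l \<le> ?n" "d \<in> block_cols lam j" "c \<in> block_cols lam l" "?Q i c d" by auto
    have "col_height lam d = j" "col_height lam c = l" "c < d" "1 \<le> c"
      using h col_height_block[OF assms, of j d] col_height_block[OF assms, of l c] lt[of d j c l]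
      by (auto simp: block_cols_def)
    then show ?case using x h by auto
  qed
  also have "\<dots> = card ?T"
  \<comment> \<open>The heights \<open>j\<close> and \<open>l\<close> are not recorded in the
    triple, but they are determined by the columns \<open>d\<close> and \<open>c\<close>.\<close>
  proof (rule card_image, rule inj_onI)
    fix x y assume xT: "x \<in> ?T" and yT: "y \<in> ?T"
      and eq: "(\<lambda>((i, j), l, d, c). ((i + 1, c), (i, c), (i, d))) x =
        (\<lambda>((i, j), l, d, c). ((i + 1, c), (i, c), (i, d))) y"
    obtain i j l d c where x: "x = ((i, j), l, d, c)" by (metis surj_pair)
    obtain i' j' l' d' c' where y: "y = ((i', j'), l', d', c')" by (metis surj_pair)
    have "col_height lam d = j" "col_height lam c = l" "col_height lam d' = j'" "col_height lam c' = l'"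
      using xT yT x y col_height_block[OF assms] by auto
    then show "x = y" using eq x y by auto
  qed
  finally have "quinv_bar lam \<sigma> = card ?T" .
  moreover have "int (card ?T) = (\<Sum>p\<in>?I. \<Sum>l=snd p+1..?n. \<Sum>d\<in>block_cols lam (snd p).
      \<Sum>c\<in>block_cols lam l. of_bool (?Q (fst p) c d))"
    using finI finB by (simp add: Int_def)
  ultimately show ?thesis by (simp only: case_prod_unfold)
qed

text \<open>The weight depends only on the row and on the taller height. Exchanging the sums
  collects, for fixed \<open>i\<close> and \<open>l\<close>, the block sizes of all \<open>j\<close>
  with \<open>i \<le> j < l\<close>, and these telescope.\<close>

lemma sum_descents_shorter:
  fixes w :: "nat \<Rightarrow> nat \<Rightarrow> int"
  assumes "is_partition lam"
  shows "(\<Sum>(i, j) | 1 \<le> i \<and> i \<le> j \<and> j \<le> n. \<Sum>l=j+1..n. int (card (block_cols lam j)) * w i l) =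
    (\<Sum>(i, j) | 1 \<le> i \<and> i \<le> j \<and> j \<le> n. (int (part lam i) - int (part lam j)) * w i j)"
proof -
  let ?I = "{(i, j). 1 \<le> i \<and> i \<le> j \<and> j \<le> n}"
  have finI: "finite ?I" by (rule finite_subset[of _ "{..n} \<times> {..n}"]) auto
  have "(\<Sum>(i, j)\<in>?I. \<Sum>l=j+1..n. int (card (block_cols lam j)) * w i l) =
      (\<Sum>(p, l)\<in>(SIGMA p:?I. {snd p+1..n}). int (card (block_cols lam (snd p))) * w (fst p) l)"
    unfolding case_prod_unfold using finI by (subst sum.Sigma) (auto simp: case_prod_unfold)
  \<comment> \<open>From here on the second component of \<open>p\<close> is the taller height, and
    \<open>j\<close> is the shorter one.\<close>
  also have "\<dots> = (\<Sum>(p, j)\<in>(SIGMA p:?I. {fst p..<snd p}). int (card (block_cols lam j)) * w (fst p) (snd p))"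
    by (rule sum.reindex_bij_witness[where i = "\<lambda>((i, l), j). ((i, j), l)" and j = "\<lambda>((i, j), l). ((i, l), j)"]) auto
  also have "\<dots> = (\<Sum>p\<in>?I. (\<Sum>j=fst p..<snd p. int (card (block_cols lam j))) * w (fst p) (snd p))"
    unfolding sum_distrib_right using finI by (subst sum.Sigma) auto
  also have "\<dots> = (\<Sum>p\<in>?I. (int (part lam (fst p)) - int (part lam (snd p))) * w (fst p) (snd p))"
  proof (intro sum.cong refl, goal_cases)
    case (1 p)
    then obtain i j where p: "p = (i, j)" and ij: "1 \<le> i" "i \<le> j" by auto
    have "(\<Sum>k=i..<j. int (card (block_cols lam k))) = (\<Sum>k=i..<j. int (part lam k) - int (part lam (Suc k)))"
      using ij by (intro sum.cong refl) (simp add: card_block_cols[OF assms])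
    also have "\<dots> = int (part lam i) - int (part lam j)"
      using sum_Suc_diff'[OF ij(2), of "\<lambda>k. - int (part lam k)"] by simp
    finally show ?case by (simp add: p)
  qed
  finally show ?thesis by (simp add: case_prod_unfold)
qed

section \<open>Assembly of (a) and (b) block by block, and of (c) over pairs of heights\<close>

theorem theorem8p2:
  fixes lam :: "nat list" and \<sigma> :: "nat \<Rightarrow> nat \<Rightarrow> nat" and n N :: nat
  assumes "is_partition lam"
    and "n = length lam"
    and "\<sigma> \<in> fillings lam"
    and "canonical lam \<sigma>"
    and "N = Max (entries lam \<sigma>)"
  shows
    "(\<forall>i j. 1 \<le> i \<and> i \<le> j \<and> j \<le> n \<longrightarrow>
       (let s = s_stat lam N \<sigma> i j; ss = s_sum lam N \<sigma> i j; \<nu> = nu lam N \<sigma> i j in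
         D_stat lam \<sigma> i j =
           (int j - int i) * (\<Sum>k=1..N-1. int (s N k) - int (s k k)) \<and>
         int (eta_bar lam \<sigma> i j) =
           xi1 N s ss \<nu>
           + (\<Sum>k=1..N. int ((\<nu> k - \<nu> (k - 1)) choose 2))
           + (\<Sum>k=1..N-1. \<Sum>h=1..k. (int (s (k + 1) h) - int (s k h)) * int (s k h))
           + (\<Sum>k=1..N-1.
               (int (\<nu> (k + 1)) - int (ss (k + 1) 1 k) - int (\<nu> k) + int (ss k 1 k))
               * (int (\<nu> k) - int (ss k 1 k)))))
     \<and>
     int (quinv_bar lam \<sigma>) =
       (\<Sum>(i, j) | 1 \<le> i \<and> i \<le> j \<and> j \<le> n.
         (int (part lam i) - int (part lam j))
           * (\<Sum>k=1..N-1. int (s_stat lam N \<sigma> i j N k) - int (s_stat lam N \<sigma> i j k k))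
         + (\<Sum>k=1..N. \<Sum>l=j+1..n.
             (int (nu lam N \<sigma> i j k) - int (nu lam N \<sigma> i j (k - 1)))
             * (int (nu lam N \<sigma> i l k) - int (nu lam N \<sigma> (i + 1) l (k - 1)))))"
proof (intro conjI allI impI, goal_cases)
  case (1 i j)
  then have ij: "1 \<le> i" "i \<le> j" "j \<le> length lam" using assms(2) by auto
  interpret column_block lam N \<sigma> i j
    using column_block_fillings[OF assms(1,3,5) ij] .
  \<comment> \<open>All columns of the block have height \<open>j\<close>, so every descent
    contributes the same amount.\<close>
  have "D_stat lam \<sigma> i j = (\<Sum>c | c \<in> C \<and> \<sigma> (i + 1) c > \<sigma> i c. int j - int i)"
    unfolding D_stat_def using ij col_height_block[OF assms(1)] by (intro sum.cong refl) auto
  then have "D_stat lam \<sigma> i j = (int j - int i) * (\<Sum>k=1..N-1. int (s N k) - int (s k k))"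
    unfolding descents_card by (simp add: mult.commute)
  moreover have "canonical_rect j C \<sigma>" using assms(4) ij by (auto simp: canonical_def)
  ultimately show ?case unfolding Let_def using eta_bar_formula ij by blast
next
  case 2
  let ?I = "{(i, j). 1 \<le> i \<and> i \<le> j \<and> j \<le> n}"
  let ?B = "block_cols lam"
  let ?des = "\<lambda>i l. \<Sum>k=1..N-1. int (s_stat lam N \<sigma> i l N k) - int (s_stat lam N \<sigma> i l k k)"
  have finB: "finite (?B j)" for j
    by (rule finite_subset[of _ "{..part lam j}"]) (auto simp: block_cols_def)
  have inner: "(\<Sum>d\<in>?B j. \<Sum>c\<in>?B l. of_bool (Q_triple (\<sigma> (i + 1) c) (\<sigma> i c) (\<sigma> i d) = 0)) =
      int (card (?B j)) * ?des i l +
      (\<Sum>k=1..N. (int (nu lam N \<sigma> i j k) - int (nu lam N \<sigma> i j (k - 1)))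
        * (int (nu lam N \<sigma> i l k) - int (nu lam N \<sigma> (i + 1) l (k - 1))))"
    if ij: "1 \<le> i" "i \<le> j" "j < l" "l \<le> n" for i j l
  proof -
    interpret J: column_block lam N \<sigma> i j
      using column_block_fillings[OF assms(1,3,5)] ij assms(2) by auto
    interpret L: column_block lam N \<sigma> i l
      using column_block_fillings[OF assms(1,3,5)] ij assms(2) by auto
    let ?g = "\<lambda>k. int (nu lam N \<sigma> i l k) - int (nu lam N \<sigma> (i + 1) l (k - 1))"
    have count: "(\<Sum>c\<in>?B l. (of_bool (P c) :: int)) = int (card {c \<in> ?B l. P c})" for P
      using finB by (simp add: Int_def)
    have "(\<Sum>c\<in>?B l. (of_bool (Q_triple (\<sigma> (i + 1) c) (\<sigma> i c) (\<sigma> i d) = 0) :: int)) =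
        ?des i l + ?g (N + 1 - \<sigma> i d)" if "d \<in> ?B j" for d
    proof -
      \<comment> \<open>For \<open>k = N + 1 - x\<close> the index \<open>k\<close> selects entries
        at least \<open>x\<close>, while \<open>k - 1\<close> selects entries greater than
        \<open>x\<close>. This shift matches the weak and the strict comparison in
        \<open>Q_triple_eq_0\<close>.\<close>
      have "N + 1 - (N + 1 - \<sigma> i d) = \<sigma> i d" "N + 1 - (N + 1 - \<sigma> i d - 1) = \<sigma> i d + 1"
        using J.lower[OF that] by auto
      then have "?g (N + 1 - \<sigma> i d) =
          int (card {c \<in> ?B l. \<sigma> i d \<le> \<sigma> i c}) - int (card {c \<in> ?B l. \<sigma> i d < \<sigma> (i + 1) c})"
        unfolding nu_def by (simp add: Suc_le_eq)
      then show ?thesis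
        unfolding L.descents_card
        unfolding Q_triple_eq_0 sum.distrib sum_subtractf count by simp
    qed
    then have "(\<Sum>d\<in>?B j. \<Sum>c\<in>?B l. (of_bool (Q_triple (\<sigma> (i + 1) c) (\<sigma> i c) (\<sigma> i d) = 0) :: int)) =
        int (card (?B j)) * ?des i l + (\<Sum>d\<in>?B j. ?g (N + 1 - \<sigma> i d))"
      by (simp add: sum.distrib)
    \<comment> \<open>The summand sees \<open>d\<close> only through its entry in row
      \<open>i\<close>, so columns of height \<open>j\<close> may be grouped by that entry; the
      group sizes are differences of \<open>nu\<close>.\<close>
    also have "(\<Sum>d\<in>?B j. ?g (N + 1 - \<sigma> i d)) = (\<Sum>d | d \<in> ?B j \<and> N + 1 - \<sigma> i d \<in> {1..N}. ?g (N + 1 - \<sigma> i d))"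
      by (intro sum.cong refl set_eqI) (auto dest: J.lower)
    also have "\<dots> = (\<Sum>k\<in>{1..N}. int (card {d \<in> ?B j. N + 1 - \<sigma> i d = k}) * ?g k)"
      by (rule sum_card_fibres[symmetric]) (use finB in auto)
    also have "\<dots> = (\<Sum>k=1..N. (int (nu lam N \<sigma> i j k) - int (nu lam N \<sigma> i j (k - 1))) * ?g k)"
      by (intro sum.cong refl) (subst J.nu_diff, auto)
    finally show ?thesis .
  qed
  have "int (quinv_bar lam \<sigma>) = (\<Sum>(i, j)\<in>?I. \<Sum>l=j+1..n. int (card (?B j)) * ?des i l +
      (\<Sum>k=1..N. (int (nu lam N \<sigma> i j k) - int (nu lam N \<sigma> i j (k - 1)))
        * (int (nu lam N \<sigma> i l k) - int (nu lam N \<sigma> (i + 1) l (k - 1)))))"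
    unfolding quinv_bar_sum[OF assms(1)] assms(2)[symmetric]
    by (intro sum.cong refl; clarify; intro sum.cong refl inner) auto
  \<comment> \<open>Separates the descent part, which will telescope, from the \<open>nu\<close>
    part, where only the sums over \<open>l\<close> and \<open>k\<close> change places.\<close>
  also have "\<dots> = (\<Sum>(i, j)\<in>?I. \<Sum>l=j+1..n. int (card (?B j)) * ?des i l) +
      (\<Sum>(i, j)\<in>?I. \<Sum>k=1..N. \<Sum>l=j+1..n. (int (nu lam N \<sigma> i j k) - int (nu lam N \<sigma> i j (k - 1)))
        * (int (nu lam N \<sigma> i l k) - int (nu lam N \<sigma> (i + 1) l (k - 1))))"
    unfolding sum.distrib[symmetric] case_prod_unfold
    by (intro sum.cong refl) (simp only: sum.distrib sum.swap[of _ "{1..N}"])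
  also note sum_descents_shorter[OF assms(1)]
  finally show ?case
    unfolding case_prod_unfold sum.distrib[symmetric] .
qed

end
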